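(* Define polynomials $Q_n(x)$ and $\widehat{Q}_n(x)$ by $\frac{\mathrm{d}^n}{\mathrm{d}\theta^n}\tan\theta=Q_n(\tan\theta)$ and $\frac{\mathrm{d}^n}{\mathrm{d}\theta^n}\sec\theta=\sec\theta\cdot\widehat{Q}_n(\tan\theta)$. Then for every $n\geqslant1$, $$Q_{2n-1}(x)=\sum_{j=1}^{n}(-4)^{n-j}(2j-1)!\,U(n,j)(1+x^2)^j,\qquad Q_{2n}(x)=x\sum_{j=1}^{n}(-4)^{n-j}(2j)!\,U(n,j)(1+x^2)^j,$$ $$\widehat{Q}_{2n}(x)=\sum_{j=0}^{n}(-1)^{n-j}(2j)!\,V(n,j)(1+x^2)^j,\qquad \widehat{Q}_{2n+1}(x)=x\sum_{j=0}^{n}(-1)^{n-j}(2j+1)!\,V(n,j)(1+x^2)^j.$$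
   Context: Equivalently $Q_0(x)=x$, $Q_{n+1}(x)=(1+x^2)Q_n'(x)$, $\widehat{Q}_0(x)=1$, $\widehat{Q}_{n+1}(x)=(1+x^2)\widehat{Q}_n'(x)+x\widehat{Q}_n(x)$. The numbers $U(n,k)$ ($n\geqslant1$) are defined by $U(1,1)=1$, $U(1,k)=0$ for $k\neq1$, $U(n,k)=U(n-1,k-1)+k^2U(n-1,k)$. The numbers $V(n,k)$ ($n,k\geqslant0$) are defined by $V(0,0)=1$, $V(0,k)=0$ for $k\neq0$, $V(n,k)=V(n-1,k-1)+(2k+1)^2V(n-1,k)$. *)

theory Defs
  imports "HOL-Analysis.Analysis" "HOL-Computational_Algebra.Polynomial"
begin

definition sec :: "real \<Rightarrow> real" where
  "sec \<theta> = 1 / cos \<theta>"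

(* The guard cos \<theta> \<noteq> 0 restricts to the domain of tan and sec: in HOL both are totalised
   to 0 at the poles.  Existence and uniqueness of the described polynomials is ex1_tan_deriv_poly
   and ex1_sec_deriv_poly below. *)
definition tan_deriv_poly :: "nat \<Rightarrow> real poly" where
  "tan_deriv_poly n =
     (THE p. \<forall>\<theta>. cos \<theta> \<noteq> 0 \<longrightarrow> (deriv ^^ n) tan \<theta> = poly p (tan \<theta>))"

definition sec_deriv_poly :: "nat \<Rightarrow> real poly" where
  "sec_deriv_poly n =
     (THE p. \<forall>\<theta>. cos \<theta> \<noteq> 0 \<longrightarrow> (deriv ^^ n) sec \<theta> = sec \<theta> * poly p (tan \<theta>))"

(* The triangle starts in row 1; row 0 is a dummy value.  Entries with a negative second index
   are 0. *)
fun U :: "nat \<Rightarrow> nat \<Rightarrow> nat" where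
  "U 0 k = 0"
| "U (Suc 0) k = (if k = 1 then 1 else 0)"
| "U (Suc (Suc n)) k = (if k = 0 then 0 else U (Suc n) (k - 1)) + k\<^sup>2 * U (Suc n) k"

fun V :: "nat \<Rightarrow> nat \<Rightarrow> nat" where
  "V 0 k = (if k = 0 then 1 else 0)"
| "V (Suc n) k = (if k = 0 then 0 else V n (k - 1)) + (2 * k + 1)\<^sup>2 * V n k"

lemma real_poly_eqI_tan:
  fixes p q :: "real poly"
  assumes "\<And>\<theta>. cos \<theta> \<noteq> 0 \<Longrightarrow> poly p (tan \<theta>) = poly q (tan \<theta>)"
  shows "p = q"
proof -
  have "poly p x = poly q x" for x
    using assms[of "arctan x"] by (simp add: tan_arctan)
  then show ?thesis
    by (simp add: poly_eq_poly_eq_iff[symmetric] fun_eq_iff)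
qed

lemma open_cos_nonzero: "open {\<theta>::real. cos \<theta> \<noteq> 0}"
  by (intro open_Collect_neq continuous_intros)

lemma eventually_cos_nonzero:
  "cos (\<theta>::real) \<noteq> 0 \<Longrightarrow> eventually (\<lambda>t. cos t \<noteq> 0) (nhds \<theta>)"
  using eventually_nhds_in_open[OF open_cos_nonzero, of \<theta>] by simp

lemma tan_sec_sq: "cos (\<theta>::real) \<noteq> 0 \<Longrightarrow> inverse ((cos \<theta>)\<^sup>2) = 1 + (tan \<theta>)\<^sup>2"
  using tan_sec[of \<theta>] by (simp add: power_inverse)

lemma deriv_tan_step:
  fixes p :: "real poly"
  assumes "\<And>\<theta>. cos \<theta> \<noteq> 0 \<Longrightarrow> f \<theta> = poly p (tan \<theta>)" and "cos \<theta> \<noteq> 0"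
  shows "deriv f \<theta> = poly ([:1, 0, 1:] * pderiv p) (tan \<theta>)"
proof -
  have "deriv f \<theta> = deriv (\<lambda>t. poly p (tan t)) \<theta>"
    by (rule deriv_cong_ev[OF eventually_mono[OF eventually_cos_nonzero[OF assms(2)] assms(1)] refl])
  also have "\<dots> = poly (pderiv p) (tan \<theta>) * inverse ((cos \<theta>)\<^sup>2)"
    by (rule DERIV_imp_deriv, rule DERIV_chain2[OF poly_DERIV DERIV_tan[OF assms(2)]])
  finally show ?thesis
    unfolding tan_sec_sq[OF assms(2)] by (simp add: power2_eq_square algebra_simps)
qed

lemma deriv_sec_step:
  fixes p :: "real poly"
  assumes "\<And>\<theta>. cos \<theta> \<noteq> 0 \<Longrightarrow> f \<theta> = sec \<theta> * poly p (tan \<theta>)" and "cos \<theta> \<noteq> 0"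
  shows "deriv f \<theta> = sec \<theta> * poly ([:1, 0, 1:] * pderiv p + [:0, 1:] * p) (tan \<theta>)"
proof -
  have "deriv f \<theta> = deriv (\<lambda>t. sec t * poly p (tan t)) \<theta>"
    by (rule deriv_cong_ev[OF eventually_mono[OF eventually_cos_nonzero[OF assms(2)] assms(1)] refl])
  moreover have "(sec has_real_derivative sec \<theta> * tan \<theta>) (at \<theta>)"
    unfolding sec_def [abs_def] using assms(2)
    by (auto intro!: derivative_eq_intros simp: tan_def field_simps power2_eq_square)
  then have "((\<lambda>t. sec t * poly p (tan t)) has_real_derivative
      (sec \<theta> * tan \<theta> * poly p (tan \<theta>)
        + poly (pderiv p) (tan \<theta>) * inverse ((cos \<theta>)\<^sup>2) * sec \<theta>)) (at \<theta>)"
    by (rule DERIV_mult[OF _ DERIV_chain2[OF poly_DERIV DERIV_tan[OF assms(2)]]])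
  ultimately have "deriv f \<theta> = sec \<theta> * tan \<theta> * poly p (tan \<theta>)
      + poly (pderiv p) (tan \<theta>) * inverse ((cos \<theta>)\<^sup>2) * sec \<theta>"
    by (simp add: DERIV_imp_deriv)
  then show ?thesis
    unfolding tan_sec_sq[OF assms(2)] by (simp add: power2_eq_square algebra_simps)
qed

lemma ex1_tan_deriv_poly:
  "\<exists>!p :: real poly. \<forall>\<theta>. cos \<theta> \<noteq> 0 \<longrightarrow> (deriv ^^ n) tan \<theta> = poly p (tan \<theta>)"
proof (rule ex_ex1I)
  show "\<exists>p :: real poly. \<forall>\<theta>. cos \<theta> \<noteq> 0 \<longrightarrow> (deriv ^^ n) tan \<theta> = poly p (tan \<theta>)"
  proof (induction n)
    case 0
    show ?case by (rule exI[of _ "[:0, 1:]"]) simp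
  next
    case (Suc n)
    then obtain p :: "real poly" where "\<And>\<theta>. cos \<theta> \<noteq> 0 \<Longrightarrow> (deriv ^^ n) tan \<theta> = poly p (tan \<theta>)"
      by blast
    from deriv_tan_step[OF this] show ?case
      by (intro exI[of _ "[:1, 0, 1:] * pderiv p"]) simp
  qed
qed (rule real_poly_eqI_tan, metis)

lemma ex1_sec_deriv_poly:
  "\<exists>!p :: real poly. \<forall>\<theta>. cos \<theta> \<noteq> 0 \<longrightarrow> (deriv ^^ n) sec \<theta> = sec \<theta> * poly p (tan \<theta>)"
proof (rule ex_ex1I)
  show "\<exists>p :: real poly. \<forall>\<theta>. cos \<theta> \<noteq> 0 \<longrightarrow> (deriv ^^ n) sec \<theta> = sec \<theta> * poly p (tan \<theta>)"
  proof (induction n)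
    case 0
    show ?case by (rule exI[of _ 1]) simp
  next
    case (Suc n)
    then obtain p :: "real poly" where "\<And>\<theta>. cos \<theta> \<noteq> 0 \<Longrightarrow> (deriv ^^ n) sec \<theta> = sec \<theta> * poly p (tan \<theta>)"
      by blast
    from deriv_sec_step[OF this] show ?case
      by (intro exI[of _ "[:1, 0, 1:] * pderiv p + [:0, 1:] * p"]) simp
  qed
next
  fix p q :: "real poly"
  assume *: "\<forall>\<theta>. cos \<theta> \<noteq> 0 \<longrightarrow> (deriv ^^ n) sec \<theta> = sec \<theta> * poly p (tan \<theta>)"
    "\<forall>\<theta>. cos \<theta> \<noteq> 0 \<longrightarrow> (deriv ^^ n) sec \<theta> = sec \<theta> * poly q (tan \<theta>)"
  show "p = q"
  proof (rule real_poly_eqI_tan)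
    fix \<theta> :: real
    assume "cos \<theta> \<noteq> 0"
    moreover from this have "sec \<theta> \<noteq> 0" by (simp add: sec_def)
    ultimately show "poly p (tan \<theta>) = poly q (tan \<theta>)"
      using * by (metis mult_left_cancel)
  qed
qed

end

theory Submission imports Defs begin

(* With W = 1 + x^2 and S p = W p' + e x p, where e = 0 for the tangent and e = 1 for the secant,
   one has S(W^j) = (2j+e) x W^j and S(x W^j) = (2j+1+e) W^(j+1) - (2j+e) W^j.  Hence even and odd
   derivatives alternate between combinations of the W^j and x times such combinations, and two
   steps turn the coefficients into the defining recurrences of U and V. *)

text \<open>Uniqueness in \<open>ex1_tan_deriv_poly\<close> reduces an equation for
  \<open>THE\<close> to a check on the iterated derivatives of \<open>tan\<close>.\<close>

lemma tan_deriv_poly_eqI: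
  assumes "\<And>\<theta>. cos \<theta> \<noteq> 0 \<Longrightarrow> (deriv ^^ n) tan \<theta> = poly p (tan \<theta>)"
  shows "tan_deriv_poly n = p"
  unfolding tan_deriv_poly_def by (rule the1_equality[OF ex1_tan_deriv_poly]) (simp add: assms)

lemma tan_deriv_poly:
  assumes "cos \<theta> \<noteq> 0"
  shows "(deriv ^^ n) tan \<theta> = poly (tan_deriv_poly n) (tan \<theta>)"
  using theI'[OF ex1_tan_deriv_poly[of n]] assms unfolding tan_deriv_poly_def by blast

lemma tan_deriv_poly_0: "tan_deriv_poly 0 = [:0, 1:]"
  by (rule tan_deriv_poly_eqI) simp

lemma tan_deriv_poly_Suc: "tan_deriv_poly (Suc n) = [:1, 0, 1:] * pderiv (tan_deriv_poly n)"
  by (rule tan_deriv_poly_eqI, unfold funpow.simps o_def, rule deriv_tan_step)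
    (rule tan_deriv_poly)

lemma sec_deriv_poly_eqI:
  assumes "\<And>\<theta>. cos \<theta> \<noteq> 0 \<Longrightarrow> (deriv ^^ n) sec \<theta> = sec \<theta> * poly p (tan \<theta>)"
  shows "sec_deriv_poly n = p"
  unfolding sec_deriv_poly_def by (rule the1_equality[OF ex1_sec_deriv_poly]) (simp add: assms)

lemma sec_deriv_poly:
  assumes "cos \<theta> \<noteq> 0"
  shows "(deriv ^^ n) sec \<theta> = sec \<theta> * poly (sec_deriv_poly n) (tan \<theta>)"
  using theI'[OF ex1_sec_deriv_poly[of n]] assms unfolding sec_deriv_poly_def by blast

lemma sec_deriv_poly_0: "sec_deriv_poly 0 = 1"
  by (rule sec_deriv_poly_eqI) simp

lemma sec_deriv_poly_Suc:
  "sec_deriv_poly (Suc n) = [:1, 0, 1:] * pderiv (sec_deriv_poly n) + [:0, 1:] * sec_deriv_poly n"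
  by (rule sec_deriv_poly_eqI, unfold funpow.simps o_def, rule deriv_sec_step)
    (rule sec_deriv_poly)

text \<open>The operator S of the overview; keeping \<open>e\<close> as a parameter lets both
  families share all computations below.\<close>

definition deriv_step :: "real \<Rightarrow> real poly \<Rightarrow> real poly" where
  "deriv_step e p = [:1, 0, 1:] * pderiv p + smult e ([:0, 1:] * p)"

lemma tan_deriv_poly_Suc': "tan_deriv_poly (Suc n) = deriv_step 0 (tan_deriv_poly n)"
  by (simp add: tan_deriv_poly_Suc deriv_step_def)

lemma sec_deriv_poly_Suc': "sec_deriv_poly (Suc n) = deriv_step 1 (sec_deriv_poly n)"
  by (simp add: sec_deriv_poly_Suc deriv_step_def)

lemma deriv_step_smult: "deriv_step e (smult c p) = smult c (deriv_step e p)"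
  by (simp only: deriv_step_def pderiv_smult mult_smult_right smult_add_right smult_smult mult_smult_left mult.commute[of c])

lemma deriv_step_add: "deriv_step e (p + q) = deriv_step e p + deriv_step e q"
  by (simp only: deriv_step_def pderiv_add distrib_left smult_add_right add_ac)

lemma deriv_step_sum: "deriv_step e (sum f A) = (\<Sum>j\<in>A. deriv_step e (f j))"
  by (induction A rule: infinite_finite_induct) (simp_all add: deriv_step_add, simp_all add: deriv_step_def)

text \<open>Passing to values turns the identities for \<open>deriv_step\<close> into real algebra;
  a real polynomial is determined by its values.\<close>

lemma poly_deriv_step:
  "poly (deriv_step e p) x = (1 + x\<^sup>2) * poly (pderiv p) x + e * (x * poly p x)"
  by (simp add: deriv_step_def power2_eq_square algebra_simps)

text \<open>Keeping the factor 1 + x^2 on the left avoids the exponent j - 1, so that j = 0 is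
  covered too.\<close>

lemma poly_pderiv_power:
  fixes x :: real
  shows "(1 + x\<^sup>2) * poly (pderiv ([:1, 0, 1:] ^ j)) x = 2 * real j * x * (1 + x\<^sup>2) ^ j"
proof (cases j)
  case (Suc k)
  have "poly (pderiv ([:1, 0, 1:] ^ Suc k)) x = 2 * real (Suc k) * x * (1 + x\<^sup>2) ^ k"
    unfolding pderiv_power_Suc by (simp add: pderiv_pCons power2_eq_square)
  then show ?thesis
    by (simp add: Suc)
qed simp

lemma deriv_step_power:
  "deriv_step e ([:1, 0, 1:] ^ j) = smult (2 * real j + e) ([:0, 1:] * [:1, 0, 1:] ^ j)"
proof -
  have "poly (deriv_step e ([:1, 0, 1:] ^ j)) x
      = poly (smult (2 * real j + e) ([:0, 1:] * [:1, 0, 1:] ^ j)) x" for x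
    unfolding poly_deriv_step poly_pderiv_power by (simp add: power2_eq_square algebra_simps)
  then show ?thesis
    by (simp add: poly_eq_poly_eq_iff[symmetric] fun_eq_iff)
qed

text \<open>With W = 1 + x^2, the product rule gives W^(j+1) + (2j+e) x^2 W^j; replacing x^2 by W -
  1 removes x.\<close>

lemma deriv_step_X_power:
  "deriv_step e ([:0, 1:] * [:1, 0, 1:] ^ j) =
     smult (2 * real j + 1 + e) ([:1, 0, 1:] ^ Suc j) - smult (2 * real j + e) ([:1, 0, 1:] ^ j)"
proof -
  have "poly (deriv_step e ([:0, 1:] * [:1, 0, 1:] ^ j)) x =
      (1 + x\<^sup>2) * (1 + x\<^sup>2) ^ j + x * ((1 + x\<^sup>2) * poly (pderiv ([:1, 0, 1:] ^ j)) x)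
        + e * x\<^sup>2 * (1 + x\<^sup>2) ^ j" for x
    unfolding poly_deriv_step pderiv_mult
    by (simp add: pderiv_pCons power2_eq_square algebra_simps)
  also have "\<dots> x = poly (smult (2 * real j + 1 + e) ([:1, 0, 1:] ^ Suc j)
      - smult (2 * real j + e) ([:1, 0, 1:] ^ j)) x" for x
    unfolding poly_pderiv_power by (simp add: power2_eq_square algebra_simps)
  finally show ?thesis
    by (simp add: poly_eq_poly_eq_iff[symmetric] fun_eq_iff)
qed

lemma deriv_step_sum_power:
  "deriv_step e (\<Sum>j\<in>A. smult (c j) ([:1, 0, 1:] ^ j)) =
     [:0, 1:] * (\<Sum>j\<in>A. smult (c j * (2 * real j + e)) ([:1, 0, 1:] ^ j))"
  by (simp only: deriv_step_sum deriv_step_smult deriv_step_power sum_distrib_left smult_smult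
      mult_smult_right)

text \<open>Comparison of coefficients: W^(j+1) receives a contribution from \<open>c j\<close> and
  one from \<open>c (Suc j)\<close>, while W^0 receives only the one from
  \<open>c 0\<close>.\<close>

lemma deriv_step_X_sum_power:
  assumes "c (Suc n) = 0" and "d 0 = - e * c 0"
    and "\<And>j. j \<le> n \<Longrightarrow>
      d (Suc j) = (2 * real j + 1 + e) * c j - (2 * real (Suc j) + e) * c (Suc j)"
  shows "deriv_step e ([:0, 1:] * (\<Sum>j\<le>n. smult (c j) ([:1, 0, 1:] ^ j))) =
     (\<Sum>j\<le>Suc n. smult (d j) ([:1, 0, 1:] ^ j))"
proof -
  let ?W = "\<lambda>j. [:1, 0, 1::real:] ^ j"
  have "deriv_step e ([:0, 1:] * (\<Sum>j\<le>n. smult (c j) (?W j))) =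
      (\<Sum>j\<le>n. smult (c j * (2 * real j + 1 + e)) (?W (Suc j)))
        - (\<Sum>j\<le>n. smult (c j * (2 * real j + e)) (?W j))"
    by (simp only: sum_distrib_left mult_smult_right deriv_step_sum deriv_step_smult
        deriv_step_X_power smult_diff_right smult_smult sum_subtractf)
  \<comment> \<open>The added term is zero. After splitting off index 0, both sums run over W^(j+1)
    with j \<le> n.\<close>
  also have "(\<Sum>j\<le>n. smult (c j * (2 * real j + e)) (?W j)) =
      (\<Sum>j\<le>Suc n. smult (c j * (2 * real j + e)) (?W j))"
    using assms(1) by simp
  also have "(\<Sum>j\<le>n. smult (c j * (2 * real j + 1 + e)) (?W (Suc j))) - \<dots> =
      smult (d 0) (?W 0) + (\<Sum>j\<le>n. smult (d (Suc j)) (?W (Suc j)))"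
    unfolding sum.atMost_Suc_shift[of _ n]
    by (simp add: assms(2,3) smult_diff_left sum_subtractf mult.commute del: power_Suc of_nat_Suc)
  finally show ?thesis
    by (simp only: sum.atMost_Suc_shift[of _ n])
qed

lemma U_0_right: "U n 0 = 0"
  by (induction n "0 :: nat" rule: U.induct) auto

lemma U_eq_0: "n < k \<Longrightarrow> U n k = 0"
  by (induction n k rule: U.induct) auto

lemma V_eq_0: "n < k \<Longrightarrow> V n k = 0"
  by (induction n k rule: V.induct) auto

text \<open>Two steps multiply by 2j(2j+1), which raises (2j-1)! to (2j+1)!, and produce -4(j+1)^2,
  whose parts feed the power of -4 and the recurrence of \<open>U\<close>. The term at j = 0, where
  \<open>2 * j - 1\<close> truncates, vanishes by \<open>U_0_right\<close>.\<close>

lemma tan_deriv_poly_odd: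
  "tan_deriv_poly (2 * m + 1) =
     (\<Sum>j\<le>Suc m. smult ((-4) ^ (Suc m - j) * fact (2 * j - 1) * real (U (Suc m) j)) ([:1, 0, 1:] ^ j))"
proof (induction m)
  case 0
  show ?case
    by (simp add: tan_deriv_poly_Suc tan_deriv_poly_0 pderiv_pCons)
next
  case (Suc m)
  let ?c = "\<lambda>n j. (-4) ^ (n - j) * fact (2 * j - 1) * real (U n j)"
  have "tan_deriv_poly (2 * Suc m + 1) = deriv_step 0 (deriv_step 0 (tan_deriv_poly (2 * m + 1)))"
    by (simp add: tan_deriv_poly_Suc')
  also have "\<dots> = (\<Sum>j\<le>Suc (Suc m). smult (?c (Suc (Suc m)) j) ([:1, 0, 1:] ^ j))"
    unfolding Suc deriv_step_sum_power
  proof (rule deriv_step_X_sum_power)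
    fix j assume "j \<le> Suc m"
    show "?c (Suc (Suc m)) (Suc j) =
        (2 * real j + 1 + 0) * (?c (Suc m) j * (2 * real j + 0))
          - (2 * real (Suc j) + 0) * (?c (Suc m) (Suc j) * (2 * real (Suc j) + 0))"
    \<comment> \<open>At the top index the exponent in \<open>?c (Suc m) (Suc j)\<close> truncates,
      but \<open>U\<close> is zero there.\<close>
    proof (cases "j = Suc m")
      case True
      then show ?thesis
        by (simp add: U_eq_0 algebra_simps)
    next
      case False
      with \<open>j \<le> Suc m\<close> have "Suc m - j = Suc (m - j)" by simp
      \<comment> \<open>The case j = 0 is separate because 2j (2j-1)! = (2j)! fails there under
        truncation; \<open>U_0_right\<close> handles it.\<close>
      then show ?thesis
        by (cases j) (simp_all add: U_0_right algebra_simps power2_eq_square)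
    qed
  qed (simp_all add: U_eq_0 U_0_right)
  finally show ?case .
qed

text \<open>Now two steps multiply by (2j+1)(2j+2), raising (2j)! to (2j+2)!, and produce -(2j+3)^2,
  the sign change and the factor in the recurrence of \<open>V\<close>. Index 0 survives: its
  coefficient only changes sign, as \<open>V (Suc n) 0 = V n 0\<close>.\<close>

lemma sec_deriv_poly_even:
  "sec_deriv_poly (2 * n) =
     (\<Sum>j\<le>n. smult ((-1) ^ (n - j) * fact (2 * j) * real (V n j)) ([:1, 0, 1:] ^ j))"
proof (induction n)
  case 0
  show ?case
    by (simp add: sec_deriv_poly_0)
next
  case (Suc n)
  let ?c = "\<lambda>n j. (-1) ^ (n - j) * fact (2 * j) * real (V n j)"
  have "sec_deriv_poly (2 * Suc n) = deriv_step 1 (deriv_step 1 (sec_deriv_poly (2 * n)))"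
    by (simp add: sec_deriv_poly_Suc')
  also have "\<dots> = (\<Sum>j\<le>Suc n. smult (?c (Suc n) j) ([:1, 0, 1:] ^ j))"
    unfolding Suc deriv_step_sum_power
  proof (rule deriv_step_X_sum_power)
    fix j assume "j \<le> n"
    show "?c (Suc n) (Suc j) =
        (2 * real j + 1 + 1) * (?c n j * (2 * real j + 1))
          - (2 * real (Suc j) + 1) * (?c n (Suc j) * (2 * real (Suc j) + 1))"
    proof (cases "j = n")
      case True
      then show ?thesis
        by (simp add: V_eq_0 algebra_simps)
    next
      case False
      with \<open>j \<le> n\<close> have "n - j = Suc (n - Suc j)" by simp
      then show ?thesis
        by (simp add: algebra_simps power2_eq_square)
    qed
  qed (simp_all add: V_eq_0)
  finally show ?case .
qed

theorem theorem6:
  fixes n :: nat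
  assumes "n \<ge> 1"
  shows "tan_deriv_poly (2 * n - 1) =
           (\<Sum>j = 1..n. smult ((-4) ^ (n - j) * fact (2 * j - 1) * real (U n j)) ([:1, 0, 1:] ^ j))
    \<and> tan_deriv_poly (2 * n) =
           [:0, 1:] * (\<Sum>j = 1..n. smult ((-4) ^ (n - j) * fact (2 * j) * real (U n j)) ([:1, 0, 1:] ^ j))
    \<and> sec_deriv_poly (2 * n) =
           (\<Sum>j = 0..n. smult ((-1) ^ (n - j) * fact (2 * j) * real (V n j)) ([:1, 0, 1:] ^ j))
    \<and> sec_deriv_poly (2 * n + 1) =
           [:0, 1:] * (\<Sum>j = 0..n. smult ((-1) ^ (n - j) * fact (2 * j + 1) * real (V n j)) ([:1, 0, 1:] ^ j))"
proof -
  from assms obtain m where n: "n = Suc m"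
    by (cases n) auto
  let ?a = "\<lambda>j. (-4) ^ (n - j) * fact (2 * j - 1) * real (U n j)"
  let ?b = "\<lambda>j. (-1) ^ (n - j) * fact (2 * j) * real (V n j)"
  have tan_odd: "tan_deriv_poly (2 * n - 1) = (\<Sum>j = 1..n. smult (?a j) ([:1, 0, 1:] ^ j))"
    using tan_deriv_poly_odd[of m]
    by (simp add: n atMost_atLeast0 sum.atLeast_Suc_atMost[of 0] U_0_right del: U.simps)
  \<comment> \<open>One more step with e = 0 multiplies by 2j, and 2j (2j-1)! = (2j)! for j \<ge>
    1.\<close>
  have fact_tan: "?a j * (2 * real j + 0) = (-4) ^ (n - j) * fact (2 * j) * real (U n j)"
    if "j \<in> {1..n}" for j
    using that by (cases j) (simp_all add: algebra_simps)
  have "tan_deriv_poly (2 * n) = deriv_step 0 (tan_deriv_poly (2 * n - 1))"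
    by (simp add: n tan_deriv_poly_Suc')
  also have "\<dots> = [:0, 1:] *
      (\<Sum>j = 1..n. smult ((-4) ^ (n - j) * fact (2 * j) * real (U n j)) ([:1, 0, 1:] ^ j))"
    unfolding tan_odd deriv_step_sum_power using fact_tan by (simp only: cong: sum.cong)
  finally have tan_even: "tan_deriv_poly (2 * n) = \<dots>" .
  have sec_even: "sec_deriv_poly (2 * n) = (\<Sum>j = 0..n. smult (?b j) ([:1, 0, 1:] ^ j))"
    by (simp only: sec_deriv_poly_even atLeast0AtMost)
  \<comment> \<open>For e = 1 the factor is 2j+1, which completes (2j)! to (2j+1)! at every j,
    including 0.\<close>
  have fact_sec: "?b j * (2 * real j + 1) = (-1) ^ (n - j) * fact (2 * j + 1) * real (V n j)" for j
    by (simp add: algebra_simps)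
  have "sec_deriv_poly (2 * n + 1) = [:0, 1:] *
      (\<Sum>j = 0..n. smult ((-1) ^ (n - j) * fact (2 * j + 1) * real (V n j)) ([:1, 0, 1:] ^ j))"
    by (simp only: Suc_eq_plus1[symmetric] sec_deriv_poly_Suc' sec_even deriv_step_sum_power
        fact_sec[unfolded Suc_eq_plus1[symmetric]])
  with tan_odd tan_even sec_even show ?thesis
    by blast
qed

end
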